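(* Let $\gamma\in(\frac23,2]$, let $(\overline{M},\overline{g})$ be a warped product spacetime of type $0$ or $-1$ associated with $\gamma$, let $t_0>0$, let $\mathcal{A}\in\mathbb{R}$, and let $\psi_{\mathrm{hom}}(t)=\mathcal{A}\int_t^{t_0}a(s)^{-3}\,ds$ be the corresponding homogeneous wave. Let $C>0$ be a constant such that for every smooth wave $\phi$ on $(\overline M,\overline g)$, every integer $N\ge 0$, every $0<t<t_0$ and every $x\in M$, $$\left|\Delta^N\phi(t,x)\right|\le C a(t_0)^3\left(\int_t^{t_0}a(s)^{-3}\,ds\right)\left(\sqrt{E_N(t_0,\phi)}+\sqrt{E_{N+1}(t_0,\phi)}\right)+\left|\Delta^N\phi(t_0,x)\right| .$$ Let $\psi$ be a smooth wave on $(\overline M,\overline g)$ with leading coefficient $A$. If $$\left\|a(t_0)^3\partial_t\psi(t_0,\cdot)-\mathcal{A}\right\|_{C^0(M)}+\|\Delta\psi(t_0,\cdot)\|_{C^0(M)}\int_0^{t_0}a(s)\,ds+Ca(t_0)^3\left(\sqrt{E_1(t_0,\psi)}+\sqrt{E_2(t_0,\psi)}\right)\int_0^{t_0}a(s)\int_s^{t_0}a(r)^{-3}\,dr\,ds<\mathcal{A},$$ then $A$ is nonvanishing, i.e. $A(x)\neq0$ for all $x\in M$.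
   Context: $(M,g)$ is a closed three-dimensional smooth Riemannian manifold with Levi-Civita connection $\nabla$, Laplace-Beltrami operator $\Delta=g^{ij}\nabla_i\nabla_j$ and volume measure $\mathrm{vol}_M$. A warped product spacetime is $\overline M=(0,\infty)\times M$ with $\overline g=-dt^2+a(t)^2g$. It is of type $0$ (associated with $\gamma\in(\frac23,2]$) if $a(t)=t^{\frac{2}{3\gamma}}$ (normalised by scaling). It is of type $-1$ if, for some constant $B>0$, $a$ is the unique function continuous on $[0,\infty)$, positive and smooth on $(0,\infty)$, with $a(0)=0$ and $\dot a=\sqrt{\frac{8\pi B}{3}a^{2-3\gamma}+1}$ on $(0,\infty)$. A smooth wave is $\psi\in C^\infty(\overline M)$ with $-\partial_t^2\psi+a^{-2}\Delta\psi-3\frac{\dot a}{a}\partial_t\psi=0$. A homogeneous wave is one depending only on $t$. Energies: for smooth $\phi:\overline M\to\mathbb{R}$, $E(t,\phi)=\int_M |\partial_t\phi(t,\cdot)|^2+a(t)^{-2}|\nabla\phi(t,\cdot)|_g^2\,\mathrm{vol}_M$ and $E_N(t,\phi)=E(t,\Delta^N\phi)$, $E_0=E$. Leading coefficient: for a smooth wave $\psi$, $A\in C^\infty(M)$ denotes the unique smooth function with $\psi(t,x)/\chi(t)\to A(x)$ as $t\downarrow0$ uniformly in $x\in M$, where $\chi(t)=t^{1-\frac2\gamma}$ in type $0$ with $\gamma<2$, $\chi(t)=\log t$ in type $0$ with $\gamma=2$, and $\chi(t)=\int_t^\infty a(s)^{-3}ds$ in type $-1$ (such $A$ always exists). *)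

theory Defs
  imports "HOL-Analysis.Analysis"
begin

section \<open>Smooth maps between Euclidean spaces\<close>

primrec times_differentiable_on ::
  "'a::real_normed_vector set \<Rightarrow> ('a \<Rightarrow> 'b::real_normed_vector) \<Rightarrow> nat \<Rightarrow> bool" where
  "times_differentiable_on S f 0 \<longleftrightarrow> continuous_on S f"
| "times_differentiable_on S f (Suc n) \<longleftrightarrow>
     (\<forall>x\<in>S. f differentiable (at x)) \<and>
     (\<forall>v. times_differentiable_on S (\<lambda>x. frechet_derivative f (at x) v) n)"

text \<open>Intended for open \<open>S\<close>.\<close>
definition smooth_on :: "'a::real_normed_vector set \<Rightarrow> ('a \<Rightarrow> 'b::real_normed_vector) \<Rightarrow> bool" where
  "smooth_on S f \<longleftrightarrow> (\<forall>n. times_differentiable_on S f n)"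

definition partial :: "3 \<Rightarrow> (real^3 \<Rightarrow> 'b::real_normed_vector) \<Rightarrow> real^3 \<Rightarrow> 'b" where
  "partial i F y = frechet_derivative F (at y) (axis i 1)"


section \<open>Closed Riemannian three-manifolds\<close>

text \<open>The manifold is a whole type \<open>'m\<close>.  A chart is a pair of an open domain and a coordinate map,
  whose values outside the domain are irrelevant.\<close>
type_synonym 'm chart = "'m set \<times> ('m \<Rightarrow> real^3)"

abbreviation chart_dom :: "'m chart \<Rightarrow> 'm set" where
  "chart_dom c \<equiv> fst c"

abbreviation chart_map :: "'m chart \<Rightarrow> 'm \<Rightarrow> real^3" where
  "chart_map c \<equiv> snd c"

definition chart_range :: "'m chart \<Rightarrow> (real^3) set" where
  "chart_range c = chart_map c ` chart_dom c"

definition chart_inv :: "'m chart \<Rightarrow> real^3 \<Rightarrow> 'm" where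
  "chart_inv c = inv_into (chart_dom c) (chart_map c)"

definition is_chart :: "('m::topological_space) chart \<Rightarrow> bool" where
  "is_chart c \<longleftrightarrow> open (chart_dom c) \<and> open (chart_range c) \<and>
     homeomorphism (chart_dom c) (chart_range c) (chart_map c) (chart_inv c)"

text \<open>Maximality of the atlas is not required: every notion below is tested on the charts of a given
  atlas and only depends on the smooth structure it generates.\<close>
definition smooth_atlas :: "('m::topological_space) chart set \<Rightarrow> bool" where
  "smooth_atlas \<A> \<longleftrightarrow>
     (\<forall>c\<in>\<A>. is_chart c) \<and>
     (\<Union>c\<in>\<A>. chart_dom c) = UNIV \<and>
     (\<forall>c\<in>\<A>. \<forall>c'\<in>\<A>.
        smooth_on (chart_map c ` (chart_dom c \<inter> chart_dom c')) (chart_map c' \<circ> chart_inv c))"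

text \<open>A metric is given by its component matrices \<open>G c y = (g\<^sub>i\<^sub>j)\<close>, for \<open>c\<close> in the atlas and \<open>y\<close> in
  the range of \<open>c\<close>.  The last clause is the transformation law of a covariant 2-tensor.\<close>
definition riemannian_metric ::
  "('m::topological_space) chart set \<Rightarrow> ('m chart \<Rightarrow> real^3 \<Rightarrow> real^3^3) \<Rightarrow> bool" where
  "riemannian_metric \<A> G \<longleftrightarrow>
     (\<forall>c\<in>\<A>. smooth_on (chart_range c) (G c)) \<and>
     (\<forall>c\<in>\<A>. \<forall>y\<in>chart_range c.
        transpose (G c y) = G c y \<and> (\<forall>v. v \<noteq> 0 \<longrightarrow> v \<bullet> (G c y *v v) > 0)) \<and>
     (\<forall>c\<in>\<A>. \<forall>c'\<in>\<A>. \<forall>y\<in>chart_map c ` (chart_dom c \<inter> chart_dom c').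
        let \<tau> = chart_map c' \<circ> chart_inv c; J = matrix (frechet_derivative \<tau> (at y))
        in G c y = transpose J ** G c' (\<tau> y) ** J)"

definition closed_riemannian_3_manifold ::
  "('m::{t2_space,second_countable_topology}) chart set \<Rightarrow>
   ('m chart \<Rightarrow> real^3 \<Rightarrow> real^3^3) \<Rightarrow> bool" where
  "closed_riemannian_3_manifold \<A> G \<longleftrightarrow>
     compact (UNIV :: 'm set) \<and> smooth_atlas \<A> \<and> riemannian_metric \<A> G"

definition smooth_function :: "'m chart set \<Rightarrow> ('m \<Rightarrow> real) \<Rightarrow> bool" where
  "smooth_function \<A> f \<longleftrightarrow> (\<forall>c\<in>\<A>. smooth_on (chart_range c) (f \<circ> chart_inv c))"


section \<open>Connection, Laplace--Beltrami operator, volume\<close>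

text \<open>\<open>christoffel g y k i j\<close> is \<open>\<Gamma>\<^sup>k\<^sub>i\<^sub>j\<close> of the Levi-Civita connection of the coefficient
  matrix \<open>g\<close> on an open part of \<open>\<real>\<^sup>3\<close>.\<close>
definition christoffel :: "(real^3 \<Rightarrow> real^3^3) \<Rightarrow> real^3 \<Rightarrow> 3 \<Rightarrow> 3 \<Rightarrow> 3 \<Rightarrow> real" where
  "christoffel g y k i j =
     (1/2) * (\<Sum>l\<in>UNIV. matrix_inv (g y) $ k $ l *
        (partial i (\<lambda>z. g z $ j $ l) y + partial j (\<lambda>z. g z $ i $ l) y
          - partial l (\<lambda>z. g z $ i $ j) y))"

text \<open>The second covariant derivative \<open>\<nabla>\<^sub>i\<nabla>\<^sub>j F\<close> of a function.\<close>
definition hessian :: "(real^3 \<Rightarrow> real^3^3) \<Rightarrow> (real^3 \<Rightarrow> real) \<Rightarrow> real^3 \<Rightarrow> 3 \<Rightarrow> 3 \<Rightarrow> real" where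
  "hessian g F y i j =
     partial i (partial j F) y - (\<Sum>k\<in>UNIV. christoffel g y k i j * partial k F y)"

text \<open>For smooth functions on a Riemannian manifold the operators below do not depend on the chart
  around \<open>x\<close> that is used to evaluate them.\<close>
definition chart_at :: "'m chart set \<Rightarrow> 'm \<Rightarrow> 'm chart" where
  "chart_at \<A> x = (SOME c. c \<in> \<A> \<and> x \<in> chart_dom c)"

definition laplacian ::
  "'m chart set \<Rightarrow> ('m chart \<Rightarrow> real^3 \<Rightarrow> real^3^3) \<Rightarrow> ('m \<Rightarrow> real) \<Rightarrow> 'm \<Rightarrow> real" where
  "laplacian \<A> G f x =
     (let c = chart_at \<A> x; y = chart_map c x
      in \<Sum>i\<in>UNIV. \<Sum>j\<in>UNIV. matrix_inv (G c y) $ i $ j * hessian (G c) (f \<circ> chart_inv c) y i j)"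

text \<open>\<open>|\<nabla>f|\<^sub>g\<^sup>2 = g\<^sup>i\<^sup>j \<partial>\<^sub>i f \<partial>\<^sub>j f\<close>\<close>
definition grad_norm_sq ::
  "'m chart set \<Rightarrow> ('m chart \<Rightarrow> real^3 \<Rightarrow> real^3^3) \<Rightarrow> ('m \<Rightarrow> real) \<Rightarrow> 'm \<Rightarrow> real" where
  "grad_norm_sq \<A> G f x =
     (let c = chart_at \<A> x; y = chart_map c x
      in \<Sum>i\<in>UNIV. \<Sum>j\<in>UNIV. matrix_inv (G c y) $ i $ j *
           partial i (f \<circ> chart_inv c) y * partial j (f \<circ> chart_inv c) y)"

text \<open>The unique Borel measure with density \<open>\<surd>(det g)\<close> in every chart.\<close>
definition riemannian_volume ::
  "('m::topological_space) chart set \<Rightarrow> ('m chart \<Rightarrow> real^3 \<Rightarrow> real^3^3) \<Rightarrow> 'm measure" where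
  "riemannian_volume \<A> G =
     (THE \<mu>. sets \<mu> = sets borel \<and>
        (\<forall>c\<in>\<A>. \<forall>X\<in>sets borel. X \<subseteq> chart_dom c \<longrightarrow>
           emeasure \<mu> X = (\<integral>\<^sup>+ y \<in> chart_map c ` X. ennreal (sqrt (det (G c y))) \<partial>lborel)))"

text \<open>The \<open>C\<^sup>0(M)\<close> norm; only meaningful for bounded functions.\<close>
definition C0_norm :: "('m \<Rightarrow> real) \<Rightarrow> real" where
  "C0_norm f = (SUP x. \<bar>f x\<bar>)"


section \<open>Scale factors\<close>

datatype spacetime_type = Type_0 | Type_minus_1

text \<open>Only the values \<open>a t\<close> with \<open>t > 0\<close> matter in the sequel.\<close>
fun scale_factor :: "spacetime_type \<Rightarrow> real \<Rightarrow> (real \<Rightarrow> real) \<Rightarrow> bool" where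
  "scale_factor Type_0 \<gamma> a \<longleftrightarrow> (\<forall>t>0. a t = t powr (2 / (3 * \<gamma>)))"
| "scale_factor Type_minus_1 \<gamma> a \<longleftrightarrow>
     (\<exists>B>0. continuous_on {0..} a \<and> smooth_on {0<..} a \<and> (\<forall>t>0. a t > 0) \<and> a 0 = 0 \<and>
        (\<forall>t>0. (a has_real_derivative sqrt (8 * pi * B / 3 * a t powr (2 - 3 * \<gamma>) + 1)) (at t)))"

text \<open>The blow-up profile that defines the leading coefficient.\<close>
fun profile :: "spacetime_type \<Rightarrow> real \<Rightarrow> (real \<Rightarrow> real) \<Rightarrow> real \<Rightarrow> real" where
  "profile Type_0 \<gamma> a t = (if \<gamma> < 2 then t powr (1 - 2 / \<gamma>) else ln t)"
| "profile Type_minus_1 \<gamma> a t = integral {t..} (\<lambda>s. 1 / a s ^ 3)"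


section \<open>Waves and energies\<close>

text \<open>Functions on \<open>(0,\<infinity>) \<times> M\<close> are curried functions \<open>\<phi> t x\<close>; their values for \<open>t \<le> 0\<close> are irrelevant.\<close>
definition smooth_spacetime_function :: "'m chart set \<Rightarrow> (real \<Rightarrow> 'm \<Rightarrow> real) \<Rightarrow> bool" where
  "smooth_spacetime_function \<A> \<phi> \<longleftrightarrow>
     (\<forall>c\<in>\<A>. smooth_on ({0<..} \<times> chart_range c) (\<lambda>(t, y). \<phi> t (chart_inv c y)))"

definition dt :: "(real \<Rightarrow> 'm \<Rightarrow> real) \<Rightarrow> real \<Rightarrow> 'm \<Rightarrow> real" where
  "dt \<phi> t x = deriv (\<lambda>s. \<phi> s x) t"

definition smooth_wave ::
  "'m chart set \<Rightarrow> ('m chart \<Rightarrow> real^3 \<Rightarrow> real^3^3) \<Rightarrow> (real \<Rightarrow> real) \<Rightarrow>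
   (real \<Rightarrow> 'm \<Rightarrow> real) \<Rightarrow> bool" where
  "smooth_wave \<A> G a \<psi> \<longleftrightarrow>
     smooth_spacetime_function \<A> \<psi> \<and>
     (\<forall>t>0. \<forall>x. - dt (dt \<psi>) t x + laplacian \<A> G (\<psi> t) x / (a t)\<^sup>2
                 - 3 * (deriv a t / a t) * dt \<psi> t x = 0)"

definition laplacian_pow ::
  "'m chart set \<Rightarrow> ('m chart \<Rightarrow> real^3 \<Rightarrow> real^3^3) \<Rightarrow> nat \<Rightarrow>
   (real \<Rightarrow> 'm \<Rightarrow> real) \<Rightarrow> real \<Rightarrow> 'm \<Rightarrow> real" where
  "laplacian_pow \<A> G N \<phi> t = (laplacian \<A> G ^^ N) (\<phi> t)"

definition energy ::
  "('m::topological_space) chart set \<Rightarrow> ('m chart \<Rightarrow> real^3 \<Rightarrow> real^3^3) \<Rightarrow> (real \<Rightarrow> real) \<Rightarrow>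
   real \<Rightarrow> (real \<Rightarrow> 'm \<Rightarrow> real) \<Rightarrow> real" where
  "energy \<A> G a t \<phi> =
     (\<integral>x. (dt \<phi> t x)\<^sup>2 + grad_norm_sq \<A> G (\<phi> t) x / (a t)\<^sup>2 \<partial>riemannian_volume \<A> G)"

definition energy_N ::
  "('m::topological_space) chart set \<Rightarrow> ('m chart \<Rightarrow> real^3 \<Rightarrow> real^3^3) \<Rightarrow> (real \<Rightarrow> real) \<Rightarrow>
   nat \<Rightarrow> real \<Rightarrow> (real \<Rightarrow> 'm \<Rightarrow> real) \<Rightarrow> real" where
  "energy_N \<A> G a N t \<phi> = energy \<A> G a t (laplacian_pow \<A> G N \<phi>)"

definition leading_coefficient ::
  "'m chart set \<Rightarrow> spacetime_type \<Rightarrow> real \<Rightarrow> (real \<Rightarrow> real) \<Rightarrow>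
   (real \<Rightarrow> 'm \<Rightarrow> real) \<Rightarrow> ('m \<Rightarrow> real) \<Rightarrow> bool" where
  "leading_coefficient \<A> k \<gamma> a \<psi> A \<longleftrightarrow>
     smooth_function \<A> A \<and>
     uniform_limit UNIV (\<lambda>t x. \<psi> t x / profile k \<gamma> a t) A (at_right 0)"

end

(* Writing J(t) for the integral of a^-3 over [t, t0], the wave equation reads
   d/dt (a^3 dt psi) = a Lap psi. The assumed bound on Lap psi and the smallness condition keep
   a^3 dt psi above some delta > 0 on (0, t0], so psi <= psi(t0) - delta J. As J tends to infinity and
   the profile is an affine function m J + b of J, the limit A of psi / profile has m A <= -delta.
   Both types are treated at once through the two-sided bound c t^p <= a(t) <= D t^p on (0, t0] with
   p = 2 / (3 gamma) in [1/3, 1), which gives both the divergence of J and the integrability of a J. *)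
theory Submission
  imports Defs
begin

section \<open>Smooth maps on open sets: congruence and directional derivatives\<close>

text \<open>Functions that agree on an open set agree near each of its points, so their Frechet
  derivatives coincide there; the induction passes to these derivatives, which is why
  \<open>f\<close> and \<open>g\<close> vary in it.\<close>

lemma times_differentiable_on_cong:
  assumes "open S" "\<And>x. x \<in> S \<Longrightarrow> f x = g x" "times_differentiable_on S f n"
  shows "times_differentiable_on S g n"
  using assms(2,3)
proof (induction n arbitrary: f g)
  case 0
  then show ?case
    using continuous_on_cong[of S S f g] by simp
next
  case (Suc n)
  have D: "(g has_derivative frechet_derivative f (at x)) (at x)" if "x \<in> S" for x
  proof (rule has_derivative_transform_within_open[OF _ assms(1) that])
    show "(f has_derivative frechet_derivative f (at x)) (at x)"
      using Suc.prems(2) that by (simp add: frechet_derivative_works[THEN iffD1])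
  qed (use Suc.prems(1) in auto)
  have "times_differentiable_on S (\<lambda>x. frechet_derivative g (at x) v) n" for v
  proof (rule Suc.IH)
    show "frechet_derivative f (at x) v = frechet_derivative g (at x) v" if "x \<in> S" for x
      using frechet_derivative_at[OF D[OF that]] by simp
    show "times_differentiable_on S (\<lambda>x. frechet_derivative f (at x) v) n"
      using Suc.prems(2) by simp
  qed
  then show ?case
    using D by (auto simp: differentiable_def)
qed

lemma smooth_on_cong:
  assumes "open S" "\<And>x. x \<in> S \<Longrightarrow> f x = g x" "smooth_on S f"
  shows "smooth_on S g"
  unfolding smooth_on_def
proof
  fix n
  show "times_differentiable_on S g n"
    by (rule times_differentiable_on_cong[OF assms(1,2)]) (use assms(3) in \<open>auto simp: smooth_on_def\<close>)
qed

lemma smooth_on_imp_continuous_on: "smooth_on S f \<Longrightarrow> continuous_on S f"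
  unfolding smooth_on_def by (drule spec[of _ 0]) simp

lemma smooth_on_imp_has_derivative:
  assumes "smooth_on S f" "x \<in> S"
  shows "(f has_derivative frechet_derivative f (at x)) (at x)"
proof -
  have "times_differentiable_on S f (Suc 0)"
    using assms(1) by (simp only: smooth_on_def)
  then show ?thesis
    using assms(2) by (simp add: frechet_derivative_works[symmetric])
qed

lemma smooth_on_frechet_derivative:
  "smooth_on S f \<Longrightarrow> smooth_on S (\<lambda>x. frechet_derivative f (at x) v)"
  unfolding smooth_on_def
proof
  fix n
  assume "\<forall>n. times_differentiable_on S f n"
  then have "times_differentiable_on S f (Suc n)" ..
  then show "times_differentiable_on S (\<lambda>x. frechet_derivative f (at x) v) n"
    by simp
qed

section \<open>Functions on the spacetime: time derivatives and spatial continuity\<close>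

lemma chart_inv_chart_map:
  assumes "is_chart c" "x \<in> chart_dom c"
  shows "chart_inv c (chart_map c x) = x" "chart_map c x \<in> chart_range c"
proof -
  show "chart_inv c (chart_map c x) = x"
    using assms by (simp add: is_chart_def homeomorphism_def)
  show "chart_map c x \<in> chart_range c"
    using assms(2) by (simp add: chart_range_def)
qed

context
  fixes \<A> :: "('m::topological_space) chart set"
  assumes atlas: "smooth_atlas \<A>"
begin

lemma atlas_cover:
  obtains c where "c \<in> \<A>" "is_chart c" "x \<in> chart_dom c"
proof -
  have "x \<in> (\<Union>c\<in>\<A>. chart_dom c)"
    using atlas by (simp add: smooth_atlas_def)
  then obtain c where "c \<in> \<A>" "x \<in> chart_dom c"
    by blast
  moreover from this(1) have "is_chart c"
    using atlas by (simp add: smooth_atlas_def)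
  ultimately show thesis
    using that by blast
qed

text \<open>Chain rule along the line of constant \<open>y\<close>. Written as the value of a
  Frechet derivative on \<open>(1, 0)\<close>, the time derivative inherits smoothness in the
  chart.\<close>

lemma spacetime_function_time_derivative:
  assumes "c \<in> \<A>" "smooth_spacetime_function \<A> \<phi>" "t > 0" "y \<in> chart_range c"
  shows "((\<lambda>s. \<phi> s (chart_inv c y)) has_real_derivative
           frechet_derivative (\<lambda>(t, y). \<phi> t (chart_inv c y)) (at (t, y)) (1, 0)) (at t)"
proof -
  let ?F = "\<lambda>(t, y). \<phi> t (chart_inv c y)"
  let ?F' = "frechet_derivative ?F (at (t, y))"
  have F: "(?F has_derivative ?F') (at (t, y))"
    using assms by (intro smooth_on_imp_has_derivative[of "{0<..} \<times> chart_range c"])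
      (auto simp: smooth_spacetime_function_def)
  have "((\<lambda>s. ?F (s, y)) has_derivative (\<lambda>h. ?F' (h, 0))) (at t)"
    by (rule has_derivative_compose[of "\<lambda>s. (s, y)" "\<lambda>h. (h, 0)", OF _ F])
      (auto intro!: derivative_eq_intros)
  moreover have "(\<lambda>h. ?F' (h, 0)) = (*) (?F' (1, 0))"
  proof
    show "?F' (h, 0) = ?F' (1, 0) * h" for h
      using linear_scale[OF has_derivative_linear[OF F], of h "(1, 0)"] by (simp add: mult.commute)
  qed
  ultimately show ?thesis
    by (simp only: has_field_derivative_def prod.case)
qed

lemma has_real_derivative_dt:
  assumes "smooth_spacetime_function \<A> \<phi>" "t > 0"
  shows "((\<lambda>s. \<phi> s x) has_real_derivative dt \<phi> t x) (at t)"
proof -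
  obtain c where c: "c \<in> \<A>" "is_chart c" "x \<in> chart_dom c"
    by (rule atlas_cover)
  have "(\<lambda>s. \<phi> s x) field_differentiable at t"
    using spacetime_function_time_derivative[OF c(1) assms chart_inv_chart_map(2)[OF c(2,3)]]
    unfolding chart_inv_chart_map(1)[OF c(2,3)] field_differentiable_def by (rule exI)
  then show ?thesis
    unfolding dt_def by (simp add: DERIV_deriv_iff_field_differentiable)
qed

text \<open>\<open>dt\<close> is a pointwise \<open>deriv\<close>; in each chart it agrees for
  positive times with the directional derivative along \<open>(1, 0)\<close>, which is
  smooth.\<close>

lemma smooth_spacetime_function_dt:
  assumes "smooth_spacetime_function \<A> \<phi>"
  shows "smooth_spacetime_function \<A> (dt \<phi>)"
  unfolding smooth_spacetime_function_def
proof
  fix c assume c: "c \<in> \<A>"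
  let ?F = "\<lambda>(t, y). \<phi> t (chart_inv c y)"
  have "open (chart_range c)"
    using c atlas by (auto simp: smooth_atlas_def is_chart_def)
  then have "open ({0::real<..} \<times> chart_range c)"
    by (intro open_Times) auto
  then show "smooth_on ({0<..} \<times> chart_range c) (\<lambda>(t, y). dt \<phi> t (chart_inv c y))"
  proof (rule smooth_on_cong)
    show "smooth_on ({0<..} \<times> chart_range c) (\<lambda>z. frechet_derivative ?F (at z) (1, 0))"
      using assms c by (intro smooth_on_frechet_derivative) (auto simp: smooth_spacetime_function_def)
  next
    fix z :: "real \<times> (real^3)" assume "z \<in> {0<..} \<times> chart_range c"
    then show "frechet_derivative ?F (at z) (1, 0) = (\<lambda>(t, y). dt \<phi> t (chart_inv c y)) z"
      using DERIV_imp_deriv[OF spacetime_function_time_derivative[OF c assms]]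
      by (auto simp: dt_def)
  qed
qed

lemma continuous_on_spacetime_function:
  assumes "smooth_spacetime_function \<A> \<phi>" "t > 0"
  shows "continuous_on UNIV (\<phi> t)"
proof -
  have "continuous_on (chart_dom c) (\<phi> t)" if c: "c \<in> \<A>" for c
  proof -
    let ?F = "\<lambda>(t, y). \<phi> t (chart_inv c y)"
    have ch: "is_chart c"
      using c atlas by (auto simp: smooth_atlas_def)
    have "continuous_on ({0<..} \<times> chart_range c) ?F"
      using assms c smooth_on_imp_continuous_on by (auto simp: smooth_spacetime_function_def)
    moreover have "continuous_on (chart_dom c) (\<lambda>x. (t, chart_map c x))"
      using ch by (intro continuous_intros) (auto simp: is_chart_def homeomorphism_def)
    moreover have "(\<lambda>x. (t, chart_map c x)) ` chart_dom c \<subseteq> {0<..} \<times> chart_range c"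
      using assms(2) by (auto simp: chart_range_def)
    ultimately have "continuous_on (chart_dom c) (\<lambda>x. ?F (t, chart_map c x))"
      by (rule continuous_on_compose2)
    then show ?thesis
      using continuous_on_cong[of "chart_dom c" "chart_dom c" "\<lambda>x. ?F (t, chart_map c x)" "\<phi> t"]
        chart_inv_chart_map(1)[OF ch] by auto
  qed
  then have "continuous_on (\<Union>c\<in>\<A>. chart_dom c) (\<phi> t)"
    using atlas by (intro continuous_on_open_UN) (auto simp: smooth_atlas_def is_chart_def)
  then show ?thesis
    using atlas by (simp add: smooth_atlas_def)
qed

end

section \<open>Suprema over the manifold and integrals down to the singular time 0\<close>

text \<open>Compactness bounds the range, which makes the \<open>SUP\<close> in
  \<open>C0_norm\<close> a genuine upper bound.\<close>

lemma abs_le_C0_norm: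
  assumes "compact (UNIV :: 'm::topological_space set)" "continuous_on UNIV (f :: 'm \<Rightarrow> real)"
  shows "\<bar>f x\<bar> \<le> C0_norm f"
proof -
  have "bounded (range f)"
    using compact_continuous_image[OF assms(2,1)] by (rule compact_imp_bounded)
  then have "bdd_above (range (\<lambda>x. \<bar>f x\<bar>))"
    by (auto simp: bounded_iff bdd_above_def)
  then show ?thesis
    unfolding C0_norm_def by (rule cSUP_upper[OF UNIV_I])
qed

lemma has_integral_real_derivative:
  fixes F :: "real \<Rightarrow> real"
  assumes "a \<le> b" "\<And>t. a \<le> t \<Longrightarrow> t \<le> b \<Longrightarrow> (F has_real_derivative F' t) (at t)"
  shows "(F' has_integral (F b - F a)) {a..b}"
proof (rule fundamental_theorem_of_calculus[OF assms(1)])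
  fix t assume "t \<in> {a..b}"
  then have "(F has_real_derivative F' t) (at t within {a..b})"
    using assms(2)[of t] by (simp add: has_field_derivative_at_within)
  then show "(F has_vector_derivative F' t) (at t within {a..b})"
    by (simp only: has_real_derivative_iff_has_vector_derivative)
qed

text \<open>Since \<open>h\<close> may be singular at 0, measurability and domination are used on
  the half-open interval; the endpoint is then added as a null set.\<close>

lemma integrable_on_powr_dominated:
  fixes h :: "real \<Rightarrow> real"
  assumes "continuous_on {0<..T} h" "q > -1" "0 \<le> T"
    and "\<And>s. 0 < s \<Longrightarrow> s \<le> T \<Longrightarrow> \<bar>h s\<bar> \<le> K * s powr q"
  shows "h integrable_on {0..T}"
proof -
  have "(\<lambda>s. K * s powr q) integrable_on {0..T}"
    using integrable_on_powr_from_0[OF assms(2,3)] by (rule integrable_on_mult_right)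
  then have "(\<lambda>s. K * s powr q) integrable_on {0<..T}"
    by (rule integrable_spike_set) (auto intro: negligible_subset[of "{0}"])
  then have "h integrable_on {0<..T}"
  proof (rule measurable_bounded_by_integrable_imp_integrable_real[rotated])
    show "h \<in> borel_measurable (lebesgue_on {0<..T})"
      using assms(1) by (rule continuous_imp_measurable_on_sets_lebesgue) simp
  qed (use assms(4) in auto)
  then show ?thesis
    by (rule integrable_spike_set) (auto intro: negligible_subset[of "{0}"])
qed

lemma integral_tail_le:
  fixes h :: "real \<Rightarrow> real"
  assumes "h integrable_on {0..T}" "0 \<le> t" "t \<le> T"
    and "\<And>s. 0 < s \<Longrightarrow> s \<le> T \<Longrightarrow> 0 \<le> h s"
  shows "integral {t..T} h \<le> integral {0..T} h"
proof -
  define h' where "h' s = (if s = 0 then 0 else h s)" for s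
  have "integral {0..t} h = integral {0..t} h'"
    by (rule integral_spike[of "{0}"]) (auto simp: h'_def)
  moreover have "0 \<le> integral {0..t} h'"
  proof (rule integral_nonneg)
    have "h integrable_on {0..t}"
      using assms integrable_subinterval_real[of h 0 T 0 t] by auto
    then show "h' integrable_on {0..t}"
      by (rule integrable_spike[of _ _ "{0}"]) (auto simp: h'_def)
  qed (use assms in \<open>auto simp: h'_def\<close>)
  ultimately show ?thesis
    using Henstock_Kurzweil_Integration.integral_combine[OF assms(2,3,1)] by linarith
qed

lemma inverse_cube_powr:
  fixes r c p :: real
  assumes "r > 0"
  shows "1 / (c * r powr p) ^ 3 = r powr (-3 * p) / c ^ 3"
proof -
  have "(r powr p) ^ 3 = r powr (3 * p)"
    using assms by (simp add: powr_power mult.commute)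
  then show ?thesis
    by (simp add: power_mult_distrib powr_minus divide_simps)
qed

section \<open>Consequences of a two-sided power bound on the scale factor\<close>

text \<open>The bounds are imposed on \<open>(0, T]\<close> only, as \<open>a 0\<close> is
  unconstrained in type 0. The upper bound with \<open>1/3 \<le> p\<close> makes
  \<open>1 / a ^ 3\<close> non-integrable at 0; both bounds with \<open>p < 1\<close> make
  \<open>a * J\<close> integrable.\<close>

locale power_law =
  fixes a :: "real \<Rightarrow> real" and p c D T :: real
  assumes T_pos: "0 < T" and p_ge: "1/3 \<le> p" and p_less: "p < 1" and c_pos: "0 < c"
    and continuous: "continuous_on {0<..T} a"
    and lower: "0 < t \<Longrightarrow> t \<le> T \<Longrightarrow> c * t powr p \<le> a t"
    and upper: "0 < t \<Longrightarrow> t \<le> T \<Longrightarrow> a t \<le> D * t powr p"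
begin

text \<open>Up to a constant factor, the homogeneous wave that vanishes at \<open>T\<close>; it is
  the gauge for the blow-up at 0.\<close>

definition J :: "real \<Rightarrow> real" where
  "J t = integral {t..T} (\<lambda>s. 1 / a s ^ 3)"

lemma pos: "0 < t \<Longrightarrow> t \<le> T \<Longrightarrow> 0 < a t"
  using lower[of t] mult_pos_pos[OF c_pos, of "t powr p"] by simp

lemma D_pos: "0 < D"
proof -
  have "0 < D * T powr p"
    using pos[of T] upper[of T] T_pos by linarith
  then show ?thesis
    using T_pos by (simp add: zero_less_mult_iff)
qed

lemma inverse_cube_continuous:
  "0 < t \<Longrightarrow> continuous_on {t..T} (\<lambda>s. 1 / a s ^ 3)"
  by (intro continuous_intros continuous_on_subset[OF continuous]) (auto simp: less_imp_neq[OF pos, symmetric])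

lemma inverse_cube_integrable:
  "0 < t \<Longrightarrow> (\<lambda>s. 1 / a s ^ 3) integrable_on {t..T}"
  by (rule integrable_continuous_interval[OF inverse_cube_continuous])

lemma J_nonneg: "0 < t \<Longrightarrow> 0 \<le> J t"
  unfolding J_def by (rule integral_nonneg[OF inverse_cube_integrable]) (auto simp: less_imp_le[OF pos])

lemma J_continuous: "continuous_on {0<..T} J"
  unfolding continuous_on_eq_continuous_within
proof
  fix t assume t: "t \<in> {0<..T}"
  \<comment> \<open>\<open>J\<close> is unbounded near 0, so continuity at \<open>t\<close> is taken
    from the compact interval starting at \<open>t/2\<close>, which contains all points of
    \<open>{0<..T}\<close> near \<open>t\<close>.\<close>
  have "continuous_on {t/2..T} J"
    unfolding J_def using indefinite_integral_continuous_1'[OF inverse_cube_integrable] t by auto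
  then have "continuous (at t within {t/2..T}) J"
    using t by (auto simp: continuous_on_eq_continuous_within)
  moreover have "at t within {t/2..T} = at t within {0<..T}"
    using t by (intro at_within_nhd[of t "{t/2<..}"]) auto
  ultimately show "continuous (at t within {0<..T}) J"
    by simp
qed

text \<open>The lower bound on \<open>a\<close> makes \<open>J s\<close> at most a multiple of
  \<open>s powr (-2*p)\<close>, and the upper bound contributes \<open>s powr p\<close>. The
  resulting exponent \<open>-p\<close> is not sharp, but it exceeds -1, which is enough for
  integrability.\<close>

lemma scale_mult_J_le:
  assumes s: "0 < s" "s \<le> T"
  shows "a s * J s \<le> D * (T powr (1 - p) / (1 - p)) / c ^ 3 * s powr (-p)"
proof -
  let ?I = "T powr (1 - p) / (1 - p)"
  have int: "((\<lambda>r. r powr (-p)) has_integral ?I) {0..T}"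
    using has_integral_powr_from_0[of "-p" T] p_less T_pos by simp
  have ints: "(\<lambda>r. r powr (-p)) integrable_on {s..T}"
    using s by (intro integrable_continuous_interval continuous_intros) auto
  \<comment> \<open>Splitting \<open>r\<^bsup>-3p\<^esup>\<close> this way leaves a power of \<open>r\<close> that is integrable at \<open>0\<close> and costs only
    \<open>s\<^bsup>-2p\<^esup>\<close>, without distinguishing the logarithmic case \<open>p = 1/3\<close>.\<close>
  have bound: "1 / a r ^ 3 \<le> s powr (-2*p) / c ^ 3 * r powr (-p)" if r: "r \<in> {s..T}" for r
  proof -
    have "1 / a r ^ 3 \<le> 1 / (c * r powr p) ^ 3"
      using lower[of r] r s c_pos by (intro divide_left_mono power_mono) (auto intro!: mult_pos_pos zero_less_power pos)
    also have "\<dots> = r powr (-2*p) / c ^ 3 * r powr (-p)"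
      using inverse_cube_powr[of r c p] powr_add[of r "-2*p" "-p"] r s by simp
    also have "\<dots> \<le> s powr (-2*p) / c ^ 3 * r powr (-p)"
      using r s c_pos p_ge by (intro mult_right_mono divide_right_mono powr_mono2') auto
    finally show ?thesis .
  qed
  have "J s \<le> integral {s..T} (\<lambda>r. s powr (-2*p) / c ^ 3 * r powr (-p))"
    unfolding J_def using s by (intro integral_le inverse_cube_integrable bound integrable_on_mult_right ints) auto
  also have "\<dots> = s powr (-2*p) / c ^ 3 * integral {s..T} (\<lambda>r. r powr (-p))"
    by simp
  also have "\<dots> \<le> s powr (-2*p) / c ^ 3 * ?I"
  proof (rule mult_left_mono)
    show "integral {s..T} (\<lambda>r. r powr (-p)) \<le> ?I"
      using integral_tail_le[of "\<lambda>r. r powr (-p)" T s] int s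
      by (auto simp: integral_unique has_integral_integrable)
  qed (use c_pos in auto)
  finally have "a s * J s \<le> (D * s powr p) * (s powr (-2*p) / c ^ 3 * ?I)"
    using upper[OF s] D_pos J_nonneg[of s] s by (intro mult_mono) auto
  also have "\<dots> = D * ?I / c ^ 3 * (s powr p * s powr (-2*p))"
    by (simp add: ac_simps)
  also have "s powr p * s powr (-2*p) = s powr (-p)"
    by (simp add: powr_add[symmetric])
  finally show ?thesis .
qed

lemma scale_integrable: "a integrable_on {0..T}"
proof (rule integrable_on_powr_dominated[OF continuous])
  show "\<bar>a s\<bar> \<le> D * s powr p" if "0 < s" "s \<le> T" for s
    using pos[OF that] upper[OF that] by simp
qed (use T_pos p_ge in auto)

lemma scale_mult_J_integrable: "(\<lambda>s. a s * J s) integrable_on {0..T}"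
proof (rule integrable_on_powr_dominated)
  show "\<bar>a s * J s\<bar> \<le> D * (T powr (1 - p) / (1 - p)) / c ^ 3 * s powr (-p)" if "0 < s" "s \<le> T" for s
    using scale_mult_J_le[OF that] pos[OF that] J_nonneg[of s] that by (simp add: abs_mult)
  show "continuous_on {0<..T} (\<lambda>s. a s * J s)"
    by (intro continuous_on_mult continuous J_continuous)
qed (use p_less T_pos in auto)

text \<open>Since \<open>1 - 3 * p \<le> 0\<close>, the factor \<open>r powr (1 - 3 * p)\<close> of
  \<open>r powr (-3 * p)\<close> is smallest at \<open>r = T\<close>; what remains is
  \<open>1 / r\<close>, whose integral already diverges.\<close>

lemma J_ge_log:
  assumes t: "0 < t" "t \<le> T"
  shows "T powr (1 - 3 * p) / D ^ 3 * (ln T - ln t) \<le> J t"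
proof -
  have I: "((\<lambda>r. 1 / r) has_integral (ln T - ln t)) {t..T}"
    using t by (intro has_integral_real_derivative) (auto intro!: derivative_eq_intros)
  have "T powr (1 - 3 * p) / D ^ 3 * (1 / r) \<le> 1 / a r ^ 3" if r: "r \<in> {t..T}" for r
  proof -
    have "T powr (1 - 3 * p) \<le> r powr (1 - 3 * p)"
      using r t p_ge by (intro powr_mono2') auto
    then have "T powr (1 - 3 * p) / D ^ 3 * (1 / r) \<le> r powr (1 - 3 * p) / D ^ 3 * (1 / r)"
      using r t D_pos by (intro mult_right_mono divide_right_mono) auto
    also have "\<dots> = 1 / (D * r powr p) ^ 3"
      using inverse_cube_powr[of r D p] powr_add[of r "1" "-3*p"] r t by simp
    also have "\<dots> \<le> 1 / a r ^ 3"
      using upper[of r] pos[of r] r t D_pos by (intro divide_left_mono power_mono) auto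
    finally show ?thesis .
  qed
  then show ?thesis
    unfolding J_def
    using has_integral_le[OF has_integral_mult_right[OF I] integrable_integral[OF inverse_cube_integrable[OF t(1)]]]
    by blast
qed

lemma J_at_top: "filterlim J at_top (at_right 0)"
proof (rule filterlim_at_top_mono)
  show "\<forall>\<^sub>F t in at_right 0. T powr (1 - 3 * p) / D ^ 3 * (ln T - ln t) \<le> J t"
    using eventually_at_right_real[OF T_pos] by eventually_elim (rule J_ge_log; simp)
  show "filterlim (\<lambda>t. T powr (1 - 3 * p) / D ^ 3 * (ln T - ln t)) at_top (at_right 0)"
  proof (rule filterlim_tendsto_pos_mult_at_top[OF tendsto_const])
    have "filterlim (\<lambda>t. ln T + - ln t) at_top (at_right 0)"
      by (intro filterlim_tendsto_add_at_top[OF tendsto_const]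
          filterlim_compose[OF filterlim_uminus_at_top_at_bot ln_at_0])
    then show "filterlim (\<lambda>t. ln T - ln t) at_top (at_right 0)"
      by simp
  qed (use T_pos D_pos in simp)
qed

end

section \<open>Power bounds for the scale factors of both types\<close>

text \<open>The power \<open>b = a powr e\<close> removes the singularity of the equation: it
  vanishes at 0 and its slope lies between two constants on \<open>(0, T]\<close>, so the mean value
  theorem traps it between \<open>lo * t\<close> and \<open>hi * t\<close>. The bounds on
  \<open>a\<close> follow from \<open>a = b powr p\<close>.\<close>

lemma scale_factor_minus_1_power_law:
  fixes a :: "real \<Rightarrow> real"
  assumes e: "e = 3 * \<gamma> / 2" "e > 1" and p: "p * e = 1" and Q: "Q > 0" and T: "T > 0"
    and cont: "continuous_on {0..} a" and pos: "\<And>t. t > 0 \<Longrightarrow> a t > 0" and a0: "a 0 = 0"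
    and ode: "\<And>t. t > 0 \<Longrightarrow> (a has_real_derivative sqrt (Q * a t powr (2 - 3 * \<gamma>) + 1)) (at t)"
  shows "\<exists>c D. c > 0 \<and> (\<forall>t. 0 < t \<and> t \<le> T \<longrightarrow> c * t powr p \<le> a t \<and> a t \<le> D * t powr p)"
proof -
  have "continuous_on {0..T} a"
    using cont by (rule continuous_on_subset) auto
  then have "\<exists>M. \<forall>t\<in>{0..T}. a t \<le> M"
    using continuous_attains_sup[of "{0..T}" a] T by auto
  then obtain M where "\<forall>t\<in>{0..T}. a t \<le> M" ..
  then have M: "a t \<le> M" if "0 \<le> t" "t \<le> T" for t
    using that by simp
  have ppos: "p > 0"
    using p e(2) zero_less_mult_pos2[of p e] by simp
  define b where "b t = a t powr e" for t
  \<comment> \<open>\<open>lo\<close> is the slope of \<open>b\<close> with the 1 under the root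
    dropped; \<open>hi\<close> moves this 1 outside the root and uses the bound \<open>M\<close> on
    \<open>a\<close>.\<close>
  define lo where "lo = e * sqrt Q"
  define hi where "hi = e * (sqrt Q + M powr (e - 1))"
  have lo: "lo > 0"
    using e Q by (simp add: lo_def)
  \<comment> \<open>With \<open>e = 3\<gamma>/2\<close> the equation becomes \<open>b' = e \<surd>(Q + a\<^bsup>3\<gamma>-2\<^esup>)\<close>, which is bounded above and below.\<close>
  have b': "\<exists>d. (b has_real_derivative d) (at t) \<and> lo \<le> d \<and> d \<le> hi" if t: "0 < t" "t \<le> T" for t
  proof (intro exI conjI)
    let ?r = "sqrt (Q * a t powr (2 - 3 * \<gamma>) + 1)"
    \<comment> \<open>As \<open>2 - 3 * \<gamma> = 2 * (1 - e)\<close>, the root is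
      \<open>sqrt Q * a t powr (1 - e)\<close> up to an error of at most 1, and this power cancels
      the chain-rule factor \<open>a t powr (e - 1)\<close>.\<close>
    have sq: "a t powr (2 - 3 * \<gamma>) = (a t powr (1 - e))\<^sup>2"
      using e pos[OF t(1)] by (simp add: powr_power algebra_simps)
    have ne: "a t powr (e - 1) * a t powr (1 - e) = 1"
      using pos[OF t(1)] by (simp add: powr_add[symmetric])
    have "sqrt Q * a t powr (1 - e) = sqrt (Q * a t powr (2 - 3 * \<gamma>))"
      unfolding sq by (simp add: real_sqrt_mult)
    then have r: "sqrt Q * a t powr (1 - e) \<le> ?r" "?r \<le> sqrt Q * a t powr (1 - e) + 1"
      using sqrt_add_le_add_sqrt[of "Q * a t powr (2 - 3 * \<gamma>)" 1] Q by auto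
    show "(b has_real_derivative e * a t powr (e - 1) * ?r) (at t)"
      using DERIV_fun_powr[OF ode[OF t(1)] pos[OF t(1)], of e] by (simp add: b_def[abs_def])
    have "e * a t powr (e - 1) * (sqrt Q * a t powr (1 - e)) \<le> e * a t powr (e - 1) * ?r"
      using r(1) e(2) by (intro mult_left_mono) auto
    moreover have "e * a t powr (e - 1) * (sqrt Q * a t powr (1 - e)) = lo"
      using ne unfolding lo_def by (metis mult.assoc mult.commute mult.right_neutral)
    ultimately show "lo \<le> e * a t powr (e - 1) * ?r"
      by simp
    have "e * a t powr (e - 1) * ?r \<le> e * a t powr (e - 1) * (sqrt Q * a t powr (1 - e) + 1)"
      using r(2) e(2) by (intro mult_left_mono) auto
    also have "\<dots> = e * (sqrt Q * (a t powr (e - 1) * a t powr (1 - e)) + a t powr (e - 1))"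
      by (simp add: algebra_simps)
    also have "\<dots> = e * (sqrt Q + a t powr (e - 1))"
      by (simp only: ne mult_1_right)
    also have "\<dots> \<le> hi"
      unfolding hi_def using pos[OF t(1)] M[of t] e(2) t
      by (intro mult_left_mono add_left_mono powr_mono2) auto
    finally show "e * a t powr (e - 1) * ?r \<le> hi" .
  qed
  have b: "lo * t \<le> b t \<and> b t \<le> hi * t" if t: "0 < t" "t \<le> T" for t
  proof -
    have "continuous_on {0..t} b"
      unfolding b_def using pos e(2)
      by (intro continuous_on_powr' continuous_on_const continuous_on_subset[OF cont])
        (auto simp: a0 less_eq_real_def)
    moreover have "b differentiable at z" if "0 < z" "z < t" for z
      using b'[of z] that t by (auto simp: real_differentiable_def)
    ultimately obtain l z where z: "0 < z" "z < t" "(b has_real_derivative l) (at z)" "b t - b 0 = (t - 0) * l"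
      using MVT[of 0 t b] t by blast
    then obtain d where "(b has_real_derivative d) (at z)" "lo \<le> d" "d \<le> hi"
      using b'[of z] t by auto
    with z have "lo \<le> l" "l \<le> hi"
      using DERIV_unique by blast+
    then show ?thesis
      using z t by (auto simp: b_def a0 mult.commute)
  qed
  have "lo powr p * t powr p \<le> a t \<and> a t \<le> hi powr p * t powr p" if t: "0 < t" "t \<le> T" for t
  proof -
    have "a t = b t powr p"
      using pos[OF t(1)] p by (simp add: b_def powr_powr mult.commute)
    moreover have b_nonneg: "0 \<le> b t"
      by (simp add: b_def)
    moreover have "hi \<ge> 0"
      using b[OF t] mult_pos_pos[OF lo t(1)] zero_less_mult_pos2[of hi t] t(1) by linarith
    ultimately show ?thesis
      using b[OF t] t lo ppos b_nonneg by (auto simp: powr_mult[symmetric] intro!: powr_mono2)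
  qed
  then show ?thesis
    using lo by (intro exI[of _ "lo powr p"] exI[of _ "hi powr p"]) auto
qed

lemma scale_factor_has_derivative:
  assumes "scale_factor k \<gamma> a" "t > 0"
  shows "(a has_real_derivative deriv a t) (at t)"
proof (cases k)
  case Type_0
  have "((\<lambda>s. s powr (2 / (3 * \<gamma>))) has_real_derivative 2 / (3 * \<gamma>) * t powr (2 / (3 * \<gamma>) - 1)) (at t)"
    using assms by (intro has_real_derivative_powr)
  then have "(a has_real_derivative 2 / (3 * \<gamma>) * t powr (2 / (3 * \<gamma>) - 1)) (at t)"
    by (rule has_field_derivative_transform_within_open[where S="{0<..}"])
      (use assms Type_0 in auto)
  then show ?thesis
    by (auto simp: DERIV_deriv_iff_real_differentiable real_differentiable_def)
next
  case Type_minus_1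
  then show ?thesis
    using assms by (auto simp: DERIV_deriv_iff_real_differentiable real_differentiable_def)
qed

lemma scale_factor_power_law:
  assumes "scale_factor k \<gamma> a" "2/3 < \<gamma>" "\<gamma> \<le> 2" "T > 0"
  obtains c D where "power_law a (2 / (3 * \<gamma>)) c D T"
proof -
  let ?p = "2 / (3 * \<gamma>)"
  have "continuous_on {0<..} a"
    using scale_factor_has_derivative[OF assms(1)] DERIV_isCont
    by (intro continuous_at_imp_continuous_on) blast
  then have cont: "continuous_on {0<..T} a"
    by (rule continuous_on_subset) auto
  \<comment> \<open>These two bounds are \<open>\<gamma> \<le> 2\<close> and
    \<open>2/3 < \<gamma>\<close> respectively.\<close>
  have p: "1/3 \<le> ?p" "?p < 1"
    using assms by (auto simp: field_simps)
  have "\<exists>c D. c > 0 \<and> (\<forall>t. 0 < t \<and> t \<le> T \<longrightarrow> c * t powr ?p \<le> a t \<and> a t \<le> D * t powr ?p)"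
  proof (cases k)
    case Type_0
    then show ?thesis
      using assms by (intro exI[of _ 1]) auto
  next
    case Type_minus_1
    then obtain B where "B > 0" "continuous_on {0..} a" "\<forall>t>0. a t > 0" "a 0 = 0"
      "\<forall>t>0. (a has_real_derivative sqrt (8 * pi * B / 3 * a t powr (2 - 3 * \<gamma>) + 1)) (at t)"
      using assms(1) by auto
    then show ?thesis
      using assms
      by (intro scale_factor_minus_1_power_law[of "3 * \<gamma> / 2" \<gamma> _ "8 * pi * B / 3"]) auto
  qed
  then obtain c D where "c > 0" "\<And>t. 0 < t \<Longrightarrow> t \<le> T \<Longrightarrow> c * t powr ?p \<le> a t"
      "\<And>t. 0 < t \<Longrightarrow> t \<le> T \<Longrightarrow> a t \<le> D * t powr ?p"
    by blast
  with p cont assms(4) show thesis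
    by (intro that[of c D]) unfold_locales
qed

section \<open>The blow-up profile in terms of the integral of the inverse cube\<close>

text \<open>The 1 under the root keeps the slope of \<open>a\<close> at least 1, so
  \<open>a s \<ge> s\<close> and \<open>s powr (-3)\<close> dominates. The type -1 profile is
  thereby a genuine integral and not the default value 0.\<close>

lemma scale_factor_minus_1_inverse_cube_integrable:
  assumes "scale_factor Type_minus_1 \<gamma> a" "T > 0"
  shows "(\<lambda>s. 1 / a s ^ 3) integrable_on {T..}"
proof -
  obtain B where B: "B > 0" "continuous_on {0..} a" "\<And>t. t > 0 \<Longrightarrow> a t > 0" "a 0 = 0"
    "\<And>t. t > 0 \<Longrightarrow> (a has_real_derivative sqrt (8 * pi * B / 3 * a t powr (2 - 3 * \<gamma>) + 1)) (at t)"
    using assms(1) by auto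
  have ge: "s \<le> a s" if s: "s > 0" for s
  proof -
    have "continuous_on {0..s} a"
      using B(2) by (rule continuous_on_subset) auto
    moreover have "a differentiable at z" if "0 < z" for z
      using B(5)[OF that] by (auto simp: real_differentiable_def)
    ultimately obtain l z where z: "0 < z" "z < s" "(a has_real_derivative l) (at z)" "a s - a 0 = (s - 0) * l"
      using MVT[of 0 s a] s by blast
    then have "l = sqrt (8 * pi * B / 3 * a z powr (2 - 3 * \<gamma>) + 1)"
      using B(5) DERIV_unique by blast
    then have "1 \<le> l"
      using B(1) by simp
    then show ?thesis
      using z s B(4) by simp
  qed
  show ?thesis
  proof (rule measurable_bounded_by_integrable_imp_integrable_real)
    show "(\<lambda>s. 1 / a s ^ 3) \<in> borel_measurable (lebesgue_on {T..})"
      using assms(2) B(3)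
      by (intro continuous_imp_measurable_on_sets_lebesgue continuous_intros continuous_on_subset[OF B(2)])
        (auto simp: less_imp_neq[OF B(3), symmetric])
    show "(\<lambda>s. s powr (-3)) integrable_on {T..}"
      using has_integral_powr_to_inf[of "-3" T] assms(2) by auto
    show "\<bar>1 / a s ^ 3\<bar> \<le> s powr (-3)" if "s \<in> {T..}" for s
    proof -
      have s: "s > 0"
        using that assms(2) by auto
      then have "1 / a s ^ 3 \<le> 1 / s ^ 3"
        using ge[OF s] B(3)[OF s] by (intro divide_left_mono power_mono) auto
      then show ?thesis
        using B(3)[OF s] s by (simp add: powr_minus_divide)
    qed
  qed auto
qed

text \<open>In type 0 the profile is an antiderivative of a constant multiple of
  \<open>1 / a ^ 3\<close>; in type -1 it is the integral up to \<open>T\<close> plus a constant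
  tail. The slope \<open>m\<close> is \<open>2 / \<gamma> - 1\<close>, \<open>-1\<close> or
  \<open>1\<close> in the three cases, so its sign varies and only \<open>m \<noteq> 0\<close> is
  recorded.\<close>

lemma profile_affine:
  assumes "scale_factor k \<gamma> a" "2/3 < \<gamma>" "\<gamma> \<le> 2" "T > 0"
  shows "\<exists>m b. m \<noteq> 0 \<and> (\<forall>t. 0 < t \<and> t \<le> T \<longrightarrow>
           profile k \<gamma> a t = m * integral {t..T} (\<lambda>s. 1 / a s ^ 3) + b)"
proof (cases k)
  case Type_0
  have a: "1 / a s ^ 3 = s powr (-2 / \<gamma>)" if "s > 0" for s
    using inverse_cube_powr[OF that, of 1 "2 / (3 * \<gamma>)"] assms Type_0 that by simp
  show ?thesis
  proof (cases "\<gamma> < 2")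
    case True
    let ?e = "1 - 2 / \<gamma>"
    have e: "?e \<noteq> 0"
      using True assms by auto
    have J: "integral {t..T} (\<lambda>s. 1 / a s ^ 3) = T powr ?e / ?e - t powr ?e / ?e" if t: "0 < t" "t \<le> T" for t
    proof -
      have "((\<lambda>s. 1 / a s ^ 3) has_integral (T powr ?e / ?e - t powr ?e / ?e)) {t..T}"
      proof (rule has_integral_real_derivative)
        fix s assume "t \<le> s"
        then have s: "s > 0"
          using t by auto
        have "((\<lambda>s. s powr ?e / ?e) has_real_derivative (?e * s powr (?e - 1)) / ?e) (at s)"
          using s by (intro DERIV_cdivide has_real_derivative_powr)
        then show "((\<lambda>s. s powr ?e / ?e) has_real_derivative 1 / a s ^ 3) (at s)"
          using a[OF s] e True by simp
      qed (use t in auto)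
      then show ?thesis
        by (rule integral_unique)
    qed
    \<comment> \<open>Solves the formula \<open>J\<close> for \<open>t powr ?e\<close>, with
      \<open>x = T powr ?e\<close> and \<open>y = t powr ?e\<close>.\<close>
    have "y = - e * (x / e - y / e) + x" if "e \<noteq> 0" for e x y :: real
      using that by (simp add: field_simps)
    from this[OF e] have "t powr ?e = - ?e * integral {t..T} (\<lambda>s. 1 / a s ^ 3) + T powr ?e"
      if "0 < t" "t \<le> T" for t
      unfolding J[OF that] .
    moreover have "- ?e \<noteq> 0"
      using e by simp
    moreover have "profile k \<gamma> a t = t powr ?e" for t
      using Type_0 True by simp
    ultimately show ?thesis
      by metis
  next
    case False
    then have g: "\<gamma> = 2"
      using assms by simp
    have "integral {t..T} (\<lambda>s. 1 / a s ^ 3) = ln T - ln t" if t: "0 < t" "t \<le> T" for t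
    proof -
      have "((\<lambda>s. 1 / a s ^ 3) has_integral (ln T - ln t)) {t..T}"
        using t g a by (intro has_integral_real_derivative)
          (auto simp: powr_minus_divide intro!: derivative_eq_intros)
      then show ?thesis
        by (rule integral_unique)
    qed
    then show ?thesis
      using Type_0 g by (intro exI[of _ "-1"] exI[of _ "ln T"]) auto
  qed
next
  case Type_minus_1
  obtain c D where "power_law a (2 / (3 * \<gamma>)) c D T"
    using assms by (rule scale_factor_power_law)
  then interpret power_law a "2 / (3 * \<gamma>)" c D T .
  have "integral {t..} (\<lambda>s. 1 / a s ^ 3) = integral {t..T} (\<lambda>s. 1 / a s ^ 3) + integral {T..} (\<lambda>s. 1 / a s ^ 3)"
    if t: "0 < t" "t \<le> T" for t
  proof -
    \<comment> \<open>The two pieces share only the point \<open>T\<close>, a null set, so their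
      integrals add.\<close>
    have un: "{t..} = {t..T} \<union> {T..}" and int: "{t..T} \<inter> {T..} = {T}"
      using t by auto
    show ?thesis
      unfolding un using assms(1,4) Type_minus_1 t
      by (intro integral_Un inverse_cube_integrable scale_factor_minus_1_inverse_cube_integrable)
        (auto simp: int)
  qed
  then have "\<forall>t. 0 < t \<and> t \<le> T \<longrightarrow> integral {t..} (\<lambda>s. 1 / a s ^ 3)
      = 1 * integral {t..T} (\<lambda>s. 1 / a s ^ 3) + integral {T..} (\<lambda>s. 1 / a s ^ 3)"
    unfolding mult_1 by blast
  then show ?thesis
    unfolding Type_minus_1 profile.simps using one_neq_zero by blast
qed

section \<open>Passage to the limit at time 0\<close>

text \<open>Everything is divided by \<open>J\<close>: as \<open>(m * J + b) / J\<close> tends to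
  \<open>m\<close>, the quotient \<open>u / J\<close> tends to \<open>A * m\<close>, while the upper
  bound on \<open>u\<close> forces this limit to be at most \<open>- \<delta>\<close>.\<close>

lemma nonzero_leading_coefficient:
  fixes J u :: "'a \<Rightarrow> real"
  assumes F: "F \<noteq> bot" and J: "filterlim J at_top F"
    and u: "\<forall>\<^sub>F t in F. u t \<le> K - \<delta> * J t" and "\<delta> > 0" "m \<noteq> 0"
    and lim: "((\<lambda>t. u t / (m * J t + b)) \<longlongrightarrow> A) F"
  shows "A \<noteq> 0"
proof
  assume "A = 0"
  have J_pos: "\<forall>\<^sub>F t in F. 0 < J t"
    using J by (simp add: filterlim_at_top_dense)
  have J_inf: "((\<lambda>t. x / J t) \<longlongrightarrow> 0) F" for x
    by (rule tendsto_divide_0[OF tendsto_const filterlim_at_top_imp_at_infinity[OF J]])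
  have "((\<lambda>t. m + b / J t) \<longlongrightarrow> m + 0) F"
    by (intro tendsto_intros J_inf)
  moreover have "\<forall>\<^sub>F t in F. m + b / J t = (m * J t + b) / J t"
    using J_pos by eventually_elim (simp add: field_simps)
  ultimately have "((\<lambda>t. (m * J t + b) / J t) \<longlongrightarrow> m + 0) F"
    by (rule Lim_transform_eventually)
  then have m: "((\<lambda>t. (m * J t + b) / J t) \<longlongrightarrow> m) F"
    by simp
  have "((\<lambda>t. u t / (m * J t + b) * ((m * J t + b) / J t)) \<longlongrightarrow> A * m) F"
    by (intro tendsto_mult lim m)
  \<comment> \<open>Cancelling is legitimate because \<open>(m * J t + b) / J t\<close> tends to
    \<open>m \<noteq> 0\<close> and is therefore eventually nonzero.\<close>
  moreover have "\<forall>\<^sub>F t in F. u t / (m * J t + b) * ((m * J t + b) / J t) = u t / J t"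
    using tendsto_imp_eventually_ne[OF m \<open>m \<noteq> 0\<close>] by eventually_elim auto
  ultimately have "((\<lambda>t. u t / J t) \<longlongrightarrow> A * m) F"
    by (rule Lim_transform_eventually)
  moreover have "((\<lambda>t. K / J t - \<delta>) \<longlongrightarrow> 0 - \<delta>) F"
    by (intro tendsto_intros J_inf)
  moreover have "\<forall>\<^sub>F t in F. u t / J t \<le> K / J t - \<delta>"
    using u J_pos by eventually_elim (simp add: field_simps)
  ultimately have "A * m \<le> 0 - \<delta>"
    using tendsto_le[OF F] by blast
  with \<open>A = 0\<close> \<open>\<delta> > 0\<close> show False
    by simp
qed

section \<open>The wave equation as a first-order equation in time at a fixed point\<close>

lemma laplacian_wave:
  assumes "smooth_wave \<A> G a \<psi>" "t > 0" "a t \<noteq> 0"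
  shows "laplacian \<A> G (\<psi> t) x = (a t)\<^sup>2 * (dt (dt \<psi>) t x + 3 * (deriv a t / a t) * dt \<psi> t x)"
proof -
  have "- dt (dt \<psi>) t x + laplacian \<A> G (\<psi> t) x / (a t)\<^sup>2 - 3 * (deriv a t / a t) * dt \<psi> t x = 0"
    using assms(1,2) by (simp only: smooth_wave_def)
  then have "laplacian \<A> G (\<psi> t) x / (a t)\<^sup>2 = dt (dt \<psi>) t x + 3 * (deriv a t / a t) * dt \<psi> t x"
    by linarith
  then show ?thesis
    using assms(3) by (simp only: divide_eq_eq) (simp add: mult.commute)
qed

text \<open>\<open>a ^ 3\<close> is the integrating factor that absorbs the damping term
  \<open>3 * (deriv a t / a t)\<close>.\<close>

lemma has_real_derivative_cube_mult_dt:
  assumes "smooth_atlas \<A>" "smooth_wave \<A> G a \<psi>" "t > 0"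
    and a: "a t \<noteq> 0" "(a has_real_derivative deriv a t) (at t)"
  shows "((\<lambda>s. a s ^ 3 * dt \<psi> s x) has_real_derivative a t * laplacian \<A> G (\<psi> t) x) (at t)"
proof -
  have sm: "smooth_spacetime_function \<A> \<psi>"
    using assms(2) by (simp add: smooth_wave_def)
  have eq: "3 * (a t)\<^sup>2 * deriv a t * dt \<psi> t x + a t ^ 3 * dt (dt \<psi>) t x = a t * laplacian \<A> G (\<psi> t) x"
    unfolding laplacian_wave[OF assms(2,3) a(1)] using a(1)
    by (simp add: field_simps power2_eq_square power3_eq_cube)
  have "((\<lambda>s. a s ^ 3 * dt \<psi> s x) has_real_derivative
          3 * (a t)\<^sup>2 * deriv a t * dt \<psi> t x + a t ^ 3 * dt (dt \<psi>) t x) (at t)"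
    using has_real_derivative_dt[OF assms(1) smooth_spacetime_function_dt[OF assms(1) sm] assms(3)] a(2)
    by (auto intro!: derivative_eq_intros simp: algebra_simps)
  then show ?thesis
    unfolding eq .
qed

text \<open>Continuity is read off the wave equation; this avoids showing that the Laplacian, which is
  evaluated in an arbitrarily chosen chart at each point, does not depend on these choices.\<close>
lemma continuous_on_laplacian_wave:
  assumes "smooth_atlas \<A>" "smooth_wave \<A> G a \<psi>" "t > 0" "a t \<noteq> 0"
  shows "continuous_on UNIV (laplacian \<A> G (\<psi> t))"
proof -
  have "smooth_spacetime_function \<A> \<psi>"
    using assms(2) by (simp add: smooth_wave_def)
  then show ?thesis
    unfolding laplacian_wave[OF assms(2-4), abs_def]
    by (intro continuous_intros continuous_on_spacetime_function[OF assms(1) _ assms(3)]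
        smooth_spacetime_function_dt[OF assms(1)])
qed

section \<open>Integrating the derivative bounds backwards from the final time\<close>

context power_law
begin

text \<open>Reads the sign of the energy factor off the assumed pointwise bound, without examining
  the energies. A negative \<open>S\<close> violates the inequality once \<open>J t\<close> exceeds
  \<open>\<Lambda> / (- S)\<close>.\<close>

lemma nonneg_if_le_J:
  assumes "\<And>t. 0 < t \<Longrightarrow> t < T \<Longrightarrow> 0 \<le> J t * S + \<Lambda>"
  shows "0 \<le> S"
proof (rule ccontr)
  assume "\<not> 0 \<le> S"
  have "\<forall>\<^sub>F t in at_right 0. \<Lambda> / (- S) < J t"
    using J_at_top by (simp add: filterlim_at_top_dense)
  moreover have "\<forall>\<^sub>F t in at_right 0. 0 < t \<and> t < T"
    using eventually_at_right_real[OF T_pos] by auto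
  ultimately have "\<forall>\<^sub>F t in at_right (0::real). False"
  proof eventually_elim
    case (elim t)
    then show False
      using assms[of t] \<open>\<not> 0 \<le> S\<close> by (simp add: field_simps)
  qed
  then show False
    by simp
qed

text \<open>Two integrations: the first, over \<open>{s..T}\<close>, combines with
  \<open>dev\<close> to keep \<open>a s ^ 3 * u' s\<close> above \<open>\<delta>\<close>; dividing
  by the positive cube and integrating over \<open>{t..T}\<close> gives
  \<open>\<delta> * J t \<le> u T - u t\<close>. Here \<open>l\<close> stands for the Laplacian of
  the wave at a fixed point.\<close>

lemma upper_bound_of_derivative_bounds:
  assumes f: "\<And>t. 0 < t \<Longrightarrow> t \<le> T \<Longrightarrow> ((\<lambda>s. a s ^ 3 * u' s) has_real_derivative a t * l t) (at t)"
    and u: "\<And>t. 0 < t \<Longrightarrow> t \<le> T \<Longrightarrow> (u has_real_derivative u' t) (at t)"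
    and l: "\<And>t. 0 < t \<Longrightarrow> t \<le> T \<Longrightarrow> \<bar>l t\<bar> \<le> S * J t + \<Lambda>" and "0 \<le> S" "0 \<le> \<Lambda>"
    and dev: "\<bar>a T ^ 3 * u' T - \<alpha>\<bar> + \<Lambda> * integral {0..T} a + S * integral {0..T} (\<lambda>s. a s * J s) \<le> \<alpha> - \<delta>"
    and t: "0 < t" "t \<le> T"
  shows "u t \<le> u T - \<delta> * J t"
proof -
  have lower: "\<delta> \<le> a s ^ 3 * u' s" if s: "0 < s" "s \<le> T" for s
  proof -
    have 1: "((\<lambda>r. a r * l r) has_integral (a T ^ 3 * u' T - a s ^ 3 * u' s)) {s..T}"
      using s by (intro has_integral_real_derivative f) simp_all
    have i: "a integrable_on {s..T}" "(\<lambda>r. a r * J r) integrable_on {s..T}"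
      using s by (auto intro: integrable_subinterval_real[OF scale_integrable]
          integrable_subinterval_real[OF scale_mult_J_integrable])
    have 2: "((\<lambda>r. S * (a r * J r) + \<Lambda> * a r) has_integral
         (S * integral {s..T} (\<lambda>r. a r * J r) + \<Lambda> * integral {s..T} a)) {s..T}"
      by (intro has_integral_add has_integral_mult_right integrable_integral i)
    have "a r * l r \<le> S * (a r * J r) + \<Lambda> * a r" if "r \<in> {s..T}" for r
    proof -
      have "a r * l r \<le> a r * (S * J r + \<Lambda>)"
        using l[of r] pos[of r] that s by (intro mult_left_mono) auto
      then show ?thesis
        by (simp add: algebra_simps)
    qed
    then have "a T ^ 3 * u' T - a s ^ 3 * u' s
        \<le> S * integral {s..T} (\<lambda>r. a r * J r) + \<Lambda> * integral {s..T} a"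
      by (rule has_integral_le[OF 1 2])
    \<comment> \<open>Factors and integrands are nonnegative, so extending the range to
      \<open>{0..T}\<close> makes the bound uniform in \<open>s\<close>.\<close>
    also have "\<dots> \<le> S * integral {0..T} (\<lambda>r. a r * J r) + \<Lambda> * integral {0..T} a"
      using s assms(4,5)
      by (intro add_mono mult_left_mono integral_tail_le scale_integrable scale_mult_J_integrable)
        (auto intro!: mult_nonneg_nonneg simp: less_imp_le[OF pos] J_nonneg)
    finally show ?thesis
      using dev by linarith
  qed
  have 1: "(u' has_integral (u T - u t)) {t..T}"
    using t by (intro has_integral_real_derivative u) simp_all
  have 2: "((\<lambda>s. \<delta> * (1 / a s ^ 3)) has_integral \<delta> * J t) {t..T}"
    unfolding J_def by (intro has_integral_mult_right integrable_integral inverse_cube_integrable t)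
  have "\<delta> * (1 / a s ^ 3) \<le> u' s" if "s \<in> {t..T}" for s
    using lower[of s] pos[of s] that t by (simp add: field_simps)
  then have "\<delta> * J t \<le> u T - u t"
    by (rule has_integral_le[OF 2 1])
  then show ?thesis
    by simp
qed

end

section \<open>From the smallness condition at \<open>t\<^sub>0\<close> to the nonvanishing of
  \<open>A\<close>\<close>

theorem theorem5p1:
  fixes \<A> :: "('m::{t2_space,second_countable_topology}) chart set"
    and G :: "'m chart \<Rightarrow> real^3 \<Rightarrow> real^3^3"
    and k :: spacetime_type
    and \<gamma> t\<^sub>0 \<alpha> C :: real
    and a \<psi>\<^sub>h\<^sub>o\<^sub>m :: "real \<Rightarrow> real"
    and \<psi> :: "real \<Rightarrow> 'm \<Rightarrow> real"
    and A :: "'m \<Rightarrow> real"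
  assumes "2/3 < \<gamma>" and "\<gamma> \<le> 2"
    and "closed_riemannian_3_manifold \<A> G"
    and "scale_factor k \<gamma> a"
    and "t\<^sub>0 > 0"
    and "\<forall>t>0. \<psi>\<^sub>h\<^sub>o\<^sub>m t = \<alpha> * (LBINT s=t..t\<^sub>0. 1 / a s ^ 3)"
    and "C > 0"
    and "\<forall>\<phi>. smooth_wave \<A> G a \<phi> \<longrightarrow>
           (\<forall>N t x. 0 < t \<and> t < t\<^sub>0 \<longrightarrow>
              \<bar>laplacian_pow \<A> G N \<phi> t x\<bar>
                \<le> C * a t\<^sub>0 ^ 3 * integral {t..t\<^sub>0} (\<lambda>s. 1 / a s ^ 3)
                    * (sqrt (energy_N \<A> G a N t\<^sub>0 \<phi>) + sqrt (energy_N \<A> G a (Suc N) t\<^sub>0 \<phi>))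
                  + \<bar>laplacian_pow \<A> G N \<phi> t\<^sub>0 x\<bar>)"
    and "smooth_wave \<A> G a \<psi>"
    and "leading_coefficient \<A> k \<gamma> a \<psi> A"
    and "C0_norm (\<lambda>x. a t\<^sub>0 ^ 3 * dt \<psi> t\<^sub>0 x - \<alpha>)
           + C0_norm (laplacian \<A> G (\<psi> t\<^sub>0)) * integral {0..t\<^sub>0} a
           + C * a t\<^sub>0 ^ 3 * (sqrt (energy_N \<A> G a 1 t\<^sub>0 \<psi>) + sqrt (energy_N \<A> G a 2 t\<^sub>0 \<psi>))
               * integral {0..t\<^sub>0} (\<lambda>s. a s * integral {s..t\<^sub>0} (\<lambda>r. 1 / a r ^ 3))
         < \<alpha>"
  shows "\<forall>x. A x \<noteq> 0"
proof
  fix x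
  have M: "compact (UNIV :: 'm set)" "smooth_atlas \<A>"
    using assms(3) by (auto simp: closed_riemannian_3_manifold_def)
  have sm: "smooth_spacetime_function \<A> \<psi>"
    using assms(9) by (simp add: smooth_wave_def)
  obtain c D where "power_law a (2 / (3 * \<gamma>)) c D t\<^sub>0"
    using assms(4,1,2,5) by (rule scale_factor_power_law)
  then interpret power_law a "2 / (3 * \<gamma>)" c D t\<^sub>0 .
  define S where "S = C * a t\<^sub>0 ^ 3 * (sqrt (energy_N \<A> G a 1 t\<^sub>0 \<psi>) + sqrt (energy_N \<A> G a 2 t\<^sub>0 \<psi>))"
  define \<Lambda> where "\<Lambda> = C0_norm (laplacian \<A> G (\<psi> t\<^sub>0))"
  \<comment> \<open>The slack in the smallness condition, positive because that inequality is
    strict.\<close>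
  define \<delta> where "\<delta> = \<alpha> - (C0_norm (\<lambda>x. a t\<^sub>0 ^ 3 * dt \<psi> t\<^sub>0 x - \<alpha>)
    + \<Lambda> * integral {0..t\<^sub>0} a + S * integral {0..t\<^sub>0} (\<lambda>s. a s * J s))"
  have \<delta>: "\<delta> > 0"
    using assms(11) by (simp add: \<delta>_def S_def \<Lambda>_def J_def)
  have lap0: "\<bar>laplacian \<A> G (\<psi> t\<^sub>0) x\<bar> \<le> \<Lambda>"
    unfolding \<Lambda>_def using pos[of t\<^sub>0] assms(5)
    by (intro abs_le_C0_norm continuous_on_laplacian_wave[OF M(2) assms(9)] M) auto
  have dev: "\<bar>a t\<^sub>0 ^ 3 * dt \<psi> t\<^sub>0 x - \<alpha>\<bar> \<le> C0_norm (\<lambda>x. a t\<^sub>0 ^ 3 * dt \<psi> t\<^sub>0 x - \<alpha>)"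
    by (intro abs_le_C0_norm[where f = "\<lambda>x. a t\<^sub>0 ^ 3 * dt \<psi> t\<^sub>0 x - \<alpha>"] continuous_intros M
        continuous_on_spacetime_function[OF M(2) smooth_spacetime_function_dt[OF M(2) sm] assms(5)])
  \<comment> \<open>The assumed estimate with \<open>N = 1\<close>, which is where the energies of
    orders 1 and 2 come from.\<close>
  have lap: "\<bar>laplacian \<A> G (\<psi> t) x\<bar> \<le> S * J t + \<bar>laplacian \<A> G (\<psi> t\<^sub>0) x\<bar>" if "0 < t" "t < t\<^sub>0" for t
    using assms(8)[rule_format, OF assms(9), of t 1 x] that
    by (simp add: S_def J_def laplacian_pow_def numeral_2_eq_2 mult_ac)
  \<comment> \<open>A negative \<open>S\<close> is incompatible with the bound, as \<open>J t\<close> tends to infinity.\<close>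
  have S: "0 \<le> S"
  proof (rule nonneg_if_le_J)
    show "0 \<le> J t * S + \<bar>laplacian \<A> G (\<psi> t\<^sub>0) x\<bar>" if "0 < t" "t < t\<^sub>0" for t
      using lap[OF that] by (simp add: mult.commute)
  qed
  \<comment> \<open>With \<open>x\<close> fixed, the wave is a function of time alone and its
    Laplacian acts as a forcing term with known bounds.\<close>
  have "\<psi> t x \<le> \<psi> t\<^sub>0 x - \<delta> * J t" if t: "0 < t" "t \<le> t\<^sub>0" for t
  proof (rule upper_bound_of_derivative_bounds[OF _ _ _ S _ _ t])
    show "((\<lambda>s. a s ^ 3 * dt \<psi> s x) has_real_derivative a t * laplacian \<A> G (\<psi> t) x) (at t)"
      if "0 < t" "t \<le> t\<^sub>0" for t
      using that pos[of t]
      by (intro has_real_derivative_cube_mult_dt M assms scale_factor_has_derivative[OF assms(4)]) auto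
    show "((\<lambda>t. \<psi> t x) has_real_derivative dt \<psi> t x) (at t)" if "0 < t" for t
      using has_real_derivative_dt[OF M(2) sm that] .
    show "\<bar>laplacian \<A> G (\<psi> t) x\<bar> \<le> S * J t + \<Lambda>" if "0 < t" "t \<le> t\<^sub>0" for t
    \<comment> \<open>The assumed estimate covers only \<open>t < t\<^sub>0\<close>; at
      \<open>t\<^sub>0\<close> itself \<open>\<Lambda>\<close> is already a bound and the other term
      is nonnegative.\<close>
    proof (cases "t = t\<^sub>0")
      case True
      then show ?thesis
        using lap0 mult_nonneg_nonneg[OF S J_nonneg[OF that(1)]] by simp
    next
      case False
      then show ?thesis
        using lap[of t] lap0 that by linarith
    qed
    show "0 \<le> \<Lambda>"
      using lap0 by linarith
    show "\<bar>a t\<^sub>0 ^ 3 * dt \<psi> t\<^sub>0 x - \<alpha>\<bar> + \<Lambda> * integral {0..t\<^sub>0} a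
        + S * integral {0..t\<^sub>0} (\<lambda>s. a s * J s) \<le> \<alpha> - \<delta>"
      using dev by (simp add: \<delta>_def)
  qed
  then have bound: "\<forall>\<^sub>F t in at_right 0. \<psi> t x \<le> \<psi> t\<^sub>0 x - \<delta> * J t"
    using eventually_at_right_real[OF assms(5)] by (auto elim!: eventually_mono)
  obtain m b where m: "m \<noteq> 0" and prof: "\<And>t. 0 < t \<Longrightarrow> t \<le> t\<^sub>0 \<Longrightarrow> profile k \<gamma> a t = m * J t + b"
    unfolding J_def using profile_affine[OF assms(4,1,2,5)] by blast
  have "((\<lambda>t. \<psi> t x / profile k \<gamma> a t) \<longlongrightarrow> A x) (at_right 0)"
    using assms(10) by (auto simp: leading_coefficient_def intro: tendsto_uniform_limitI)
  moreover have "\<forall>\<^sub>F t in at_right 0. \<psi> t x / profile k \<gamma> a t = \<psi> t x / (m * J t + b)"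
    using eventually_at_right_real[OF assms(5)] by eventually_elim (simp add: prof)
  ultimately have "((\<lambda>t. \<psi> t x / (m * J t + b)) \<longlongrightarrow> A x) (at_right 0)"
    by (simp add: tendsto_cong)
  then show "A x \<noteq> 0"
    using nonzero_leading_coefficient[OF _ J_at_top bound \<delta> m] by simp
qed

end
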